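(* Let $\Gamma$ be a sequent and $A$ a term with $\Gamma \vdash_{\mathbb{T}} A$. Then $\Gamma$ is finite. Moreover, writing $\Gamma = B_1,\dots,B_k$, if (up to reordering and rebracketing of tensor factors) we express - $B_1 \otimes\cdots\otimes B_k = P_1\otimes\cdots\otimes P_m\otimes \mathbb{1}^{\otimes b}$ and - $A = Q_1\otimes\cdots\otimes Q_n\otimes\mathbb{1}^{\otimes a}$, where the $P_i, Q_j\in\Phi$ are atomic propositions, then $m=n$ and there exists a permutation $\pi$ of $\{1,\dots,n\}$ such that $Q_j = P_{\pi(j)}$ for all $j$. That is, modulo extra $\mathbb{1}$ factors, $\Gamma$ and $A$ are formed from precisely the same multiset of atomic propositions. Conversely, if a finite sequent $\Gamma$ and a term $A$ are formed from the same multiset of atomic propositions, modulo extra $\mathbb{1}$ factors, then $\Gamma \vdash_{\mathbb{T}} A$.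
   Context: Fix a countable set $\Phi$ of atomic propositions. Terms are generated from the elements of $\Phi$ and a constant $\mathbb{1}$ using a binary connective $\otimes$ (with parentheses). A sequent is a (possibly empty, not necessarily finite) multiset of terms; a comma denotes multiset union. An inference is an expression $\Gamma \vdash A$ with $\Gamma$ a sequent and $A$ a term. The system $\mathbb{T}$ has the following deduction rules. (Id) $P \vdash P$ for every atomic proposition $P\in\Phi$. (Cut) From $\Gamma \vdash B$ and $\Delta, B \vdash A$ deduce $\Delta,\Gamma \vdash A$, for any term $B$. (L-$\mathbb{1}$) From $\Gamma \vdash A$ deduce $\Gamma, \mathbb{1} \vdash A$. (R-$\mathbb{1}$) $\vdash \mathbb{1}$. (L-$\otimes$) From $A, B, \Gamma \vdash C$ deduce $A\otimes B, \Gamma \vdash C$. (R-$\otimes$) From $\Gamma \vdash A$ and $\Delta \vdash B$ deduce $\Gamma,\Delta \vdash A\otimes B$. (Exchange) Antecedent terms may be reordered arbitrarily (automatic when antecedents are multisets). A proof of an inference is a finite tree of rule applications with that inference as conclusion; $\Gamma\vdash_{\mathbb{T}} A$ means that $\Gamma\vdash A$ has a proof in $\mathbb{T}$. An empty tensor product is read as containing no atomic propositions. *)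

theory Defs
  imports
    "HOL-Library.Multiset"
    "HOL-Library.Extended_Nat"
    "HOL-Library.Function_Algebras"
    "HOL-Library.Countable_Set"
    "HOL-Combinatorics.Permutations"
begin

datatype 'p tm =
    Atom 'p
  | One  ("\<one>")
  | Tensor "'p tm" "'p tm"  (infixr "\<otimes>" 70)

primrec tm_atoms :: "'p tm \<Rightarrow> 'p multiset" where
  "tm_atoms (Atom P) = {#P#}"
| "tm_atoms \<one> = {#}"
| "tm_atoms (A \<otimes> B) = tm_atoms A + tm_atoms B"

definition terms_over :: "'p set \<Rightarrow> 'p tm set" where
  "terms_over \<Phi> = {A. set_tm A \<subseteq> \<Phi>}"

(* Library multisets are finite, whereas a sequent may be infinite; a sequent is therefore
   given by its multiplicity function.  Multiset union and the empty multiset are the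
   pointwise + and 0 of Function_Algebras. *)
type_synonym 'p sequent = "'p tm \<Rightarrow> enat"

definition sequent_over :: "'p set \<Rightarrow> 'p sequent \<Rightarrow> bool" where
  "sequent_over \<Phi> \<Gamma> \<longleftrightarrow> {B. \<Gamma> B \<noteq> 0} \<subseteq> terms_over \<Phi>"

definition single :: "'p tm \<Rightarrow> 'p sequent" where
  "single B = (\<lambda>C. if C = B then 1 else 0)"

definition listed :: "'p tm list \<Rightarrow> 'p sequent" where
  "listed Bs = sum_list (map single Bs)"

definition finite_sequent :: "'p sequent \<Rightarrow> bool" where
  "finite_sequent \<Gamma> \<longleftrightarrow> finite {B. \<Gamma> B \<noteq> 0} \<and> (\<forall>B. \<Gamma> B \<noteq> \<infinity>)"

(* Meaningful only for finite sequents: the sum over an infinite support is empty by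
   convention, and the_enat \<infinity> is unspecified. *)
definition sequent_atoms :: "'p sequent \<Rightarrow> 'p multiset" where
  "sequent_atoms \<Gamma> = (\<Sum>B | \<Gamma> B \<noteq> 0. repeat_mset (the_enat (\<Gamma> B)) (tm_atoms B))"

(* Exchange needs no rule, since antecedents are multisets. *)
inductive derivable :: "'p set \<Rightarrow> 'p sequent \<Rightarrow> 'p tm \<Rightarrow> bool" for \<Phi> :: "'p set" where
  Id: "P \<in> \<Phi> \<Longrightarrow> derivable \<Phi> (single (Atom P)) (Atom P)"
| Cut: "B \<in> terms_over \<Phi> \<Longrightarrow> derivable \<Phi> \<Gamma> B \<Longrightarrow> derivable \<Phi> (\<Delta> + single B) A
    \<Longrightarrow> derivable \<Phi> (\<Delta> + \<Gamma>) A"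
| L_One: "derivable \<Phi> \<Gamma> A \<Longrightarrow> derivable \<Phi> (\<Gamma> + single \<one>) A"
| R_One: "derivable \<Phi> 0 \<one>"
| L_Tensor: "derivable \<Phi> (single A + single B + \<Gamma>) C
    \<Longrightarrow> derivable \<Phi> (single (A \<otimes> B) + \<Gamma>) C"
| R_Tensor: "derivable \<Phi> \<Gamma> A \<Longrightarrow> derivable \<Phi> \<Delta> B \<Longrightarrow> derivable \<Phi> (\<Gamma> + \<Delta>) (A \<otimes> B)"

(* The empty tensor product is not itself a term; it is represented by the unit, so that it
   contains no atomic propositions.  Nonempty products introduce no extra unit. *)
fun tensor_list :: "'p tm list \<Rightarrow> 'p tm" where
  "tensor_list [] = \<one>"
| "tensor_list [A] = A"
| "tensor_list (A # B # Cs) = A \<otimes> tensor_list (B # Cs)"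

(* Equality of terms up to reordering and rebracketing of tensor factors; there are no unit
   laws, so occurrences of the unit are neither created nor deleted. *)
inductive tensor_eq :: "'p tm \<Rightarrow> 'p tm \<Rightarrow> bool"  (infix "\<simeq>" 50) where
  refl: "A \<simeq> A"
| sym: "A \<simeq> B \<Longrightarrow> B \<simeq> A"
| trans: "A \<simeq> B \<Longrightarrow> B \<simeq> C \<Longrightarrow> A \<simeq> C"
| cong: "A \<simeq> A' \<Longrightarrow> B \<simeq> B' \<Longrightarrow> A \<otimes> B \<simeq> A' \<otimes> B'"
| assoc: "(A \<otimes> B) \<otimes> C \<simeq> A \<otimes> (B \<otimes> C)"
| comm: "A \<otimes> B \<simeq> B \<otimes> A"

end

theory Submission imports Defs begin

text \<open>
  Every rule preserves the multiset of atoms: in a derivable inference the antecedent and the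
  succedent have the same atoms. For Cut this is cancellation of the atoms of the cut term.
  Conversely, the right rules derive a term from its own atoms, and the left rules then assemble
  those atoms into the terms of any finite antecedent with the same atoms; Cut is not used.
\<close>

text \<open>Embeds library multisets as exactly the finite sequents, so that multiset induction and
  sums over \<open>\<in>#\<close> become available for them.\<close>

definition mset_sequent :: "'p tm multiset \<Rightarrow> 'p sequent" where
  "mset_sequent M = (\<lambda>C. enat (count M C))"

lemma mset_sequent_empty [simp]: "mset_sequent {#} = 0"
  by (simp add: mset_sequent_def fun_eq_iff zero_enat_def)

lemma mset_sequent_union [simp]: "mset_sequent (M + N) = mset_sequent M + mset_sequent N"
  by (simp add: mset_sequent_def fun_eq_iff)

lemma mset_sequent_add_mset [simp]:
  "mset_sequent (add_mset B M) = single B + mset_sequent M"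
  by (auto simp: mset_sequent_def single_def fun_eq_iff one_enat_def)

text \<open>Addition on \<open>enat\<close> cancels only at finite values; here every total is
  finite, hence so is the remainder. This inverts the premises of \<open>Cut\<close> and
  \<open>L_Tensor\<close>, whose contexts are not known to be finite beforehand.\<close>

lemma single_plus_eq_mset_sequent:
  assumes "single B + \<Gamma> = mset_sequent M"
  obtains N where "M = add_mset B N" "\<Gamma> = mset_sequent N"
proof -
  have eq: "single B C + \<Gamma> C = enat (count M C)" for C
    using fun_cong[OF assms, of C] by (simp add: mset_sequent_def)
  have "B \<in># M"
  proof (rule ccontr)
    assume "B \<notin># M"
    with eq[of B] show False
      by (simp add: single_def not_in_iff zero_enat_def[symmetric])
  qed
  then obtain N where N: "M = add_mset B N"
    by (rule mset_add)
  have "\<Gamma> C = enat (count N C)" for C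
  proof (cases "C = B")
    case True
    with eq[of C] have "1 + \<Gamma> C = enat (Suc (count N C))"
      by (simp add: N single_def)
    then show ?thesis
      by (cases "\<Gamma> C") (simp_all add: one_enat_def)
  next
    case False
    with eq[of C] show ?thesis
      by (simp add: N single_def)
  qed
  then have "\<Gamma> = mset_sequent N"
    by (simp add: mset_sequent_def fun_eq_iff)
  with N show thesis by (rule that)
qed

lemma listed_eq_mset_sequent: "listed Bs = mset_sequent (mset Bs)"
  by (induction Bs) (simp_all add: listed_def)

lemma finite_sequent_mset_sequent: "finite_sequent (mset_sequent M)"
proof -
  have "{B. mset_sequent M B \<noteq> 0} = set_mset M"
    by (auto simp: mset_sequent_def zero_enat_def)
  then show ?thesis
    by (simp add: finite_sequent_def mset_sequent_def)
qed

lemma finite_sequentE: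
  assumes "finite_sequent \<Gamma>"
  obtains M where "\<Gamma> = mset_sequent M"
proof
  have fin: "finite {B. \<Gamma> B \<noteq> 0}" and ninf: "\<Gamma> B \<noteq> \<infinity>" for B
    using assms by (auto simp: finite_sequent_def)
  \<comment> \<open>This is the side condition under which \<open>count\<close> inverts
    \<open>Abs_multiset\<close>; the support does not grow because \<open>the_enat\<close> maps 0 to
    0.\<close>
  have fin': "finite {B. 0 < the_enat (\<Gamma> B)}"
    by (rule finite_subset[OF _ fin]) (auto simp: zero_enat_def)
  show "\<Gamma> = mset_sequent (Abs_multiset (\<lambda>B. the_enat (\<Gamma> B)))"
  proof
    fix C
    show "\<Gamma> C = mset_sequent (Abs_multiset (\<lambda>B. the_enat (\<Gamma> B))) C"
      using ninf[of C] fin' by (cases "\<Gamma> C") (simp_all add: mset_sequent_def)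
  qed
qed

lemma sequent_atoms_mset_sequent:
  "sequent_atoms (mset_sequent M) = (\<Sum>B\<in>#M. tm_atoms B)"
proof -
  have supp: "{B. mset_sequent M B \<noteq> 0} = set_mset M"
    by (auto simp: mset_sequent_def zero_enat_def)
  \<comment> \<open>The support changes as \<open>M\<close> grows, so the induction runs over a
    fixed finite superset \<open>S\<close>; terms outside the support contribute the empty
    multiset.\<close>
  have "(\<Sum>B\<in>S. repeat_mset (count M B) (tm_atoms B)) = (\<Sum>B\<in>#M. tm_atoms B)"
    if "finite S" "set_mset M \<subseteq> S" for S
    using that(2)
  proof (induction M)
    case (add B M)
    have "(\<Sum>C\<in>S. repeat_mset (count (add_mset B M) C) (tm_atoms C))
        = (\<Sum>C\<in>S. (if C = B then tm_atoms C else {#}) + repeat_mset (count M C) (tm_atoms C))"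
      by (rule sum.cong) auto
    with add \<open>finite S\<close> show ?case
      by (simp add: sum.distrib)
  qed simp
  from this[of "set_mset M"] show ?thesis
    by (simp add: sequent_atoms_def supp) (simp add: mset_sequent_def)
qed

text \<open>These simp rules would eta-expand sums of sequents.\<close>
declare plus_fun_apply [simp del] zero_fun_apply [simp del]

text \<open>One witness \<open>M\<close> carries both finiteness and the balance of atoms, since
  counting the atoms of a sequent makes sense only once it is finite.\<close>

lemma derivable_sound:
  assumes "derivable \<Phi> \<Gamma> A"
  obtains M where "\<Gamma> = mset_sequent M" "(\<Sum>B\<in>#M. tm_atoms B) = tm_atoms A"
proof -
  from assms have "\<exists>M. \<Gamma> = mset_sequent M \<and> (\<Sum>B\<in>#M. tm_atoms B) = tm_atoms A"
  proof induction
    case (Id P)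
    show ?case by (rule exI[of _ "{#Atom P#}"]) simp
  next
    case (Cut B \<Gamma> \<Delta> A)
    then obtain M N where M: "\<Gamma> = mset_sequent M" "(\<Sum>B\<in>#M. tm_atoms B) = tm_atoms B"
      and N: "single B + \<Delta> = mset_sequent N" "(\<Sum>B\<in>#N. tm_atoms B) = tm_atoms A"
      by (auto simp: add.commute)
    from N(1) obtain N' where "N = add_mset B N'" "\<Delta> = mset_sequent N'"
      by (rule single_plus_eq_mset_sequent)
    \<comment> \<open>The atoms of the cut term \<open>B\<close>, removed with it from
      \<open>N\<close>, are restored by those of \<open>M\<close>.\<close>
    with M N show ?case
      by (intro exI[of _ "N' + M"]) (simp add: add.commute)
  next
    case (L_One \<Gamma> A)
    then obtain M where "\<Gamma> = mset_sequent M" "(\<Sum>B\<in>#M. tm_atoms B) = tm_atoms A"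
      by blast
    then show ?case
      by (intro exI[of _ "add_mset \<one> M"]) (simp add: add.commute)
  next
    case R_One
    show ?case by (rule exI[of _ "{#}"]) simp
  next
    case (L_Tensor A B \<Gamma> C)
    then obtain M where M: "single A + (single B + \<Gamma>) = mset_sequent M"
      "(\<Sum>B\<in>#M. tm_atoms B) = tm_atoms C"
      by (auto simp: add.assoc)
    from M(1) obtain M' where M': "M = add_mset A M'" "single B + \<Gamma> = mset_sequent M'"
      by (rule single_plus_eq_mset_sequent)
    from M'(2) obtain N where "M' = add_mset B N" "\<Gamma> = mset_sequent N"
      by (rule single_plus_eq_mset_sequent)
    with M M' show ?case
      by (intro exI[of _ "add_mset (A \<otimes> B) N"]) (simp add: add.assoc)
  next
    case (R_Tensor \<Gamma> A \<Delta> B)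
    then obtain M N where "\<Gamma> = mset_sequent M" "(\<Sum>B\<in>#M. tm_atoms B) = tm_atoms A"
      "\<Delta> = mset_sequent N" "(\<Sum>B\<in>#N. tm_atoms B) = tm_atoms B"
      by blast
    then show ?case
      by (intro exI[of _ "M + N"]) simp
  qed
  with that show thesis by blast
qed

lemma derivable_from_atoms:
  assumes "A \<in> terms_over \<Phi>"
  shows "derivable \<Phi> (mset_sequent (image_mset Atom (tm_atoms A))) A"
  using assms
  by (induction A) (auto simp: terms_over_def intro: derivable.Id derivable.R_One derivable.R_Tensor)

text \<open>The context must stay arbitrary: while one factor of a tensor is assembled, the atoms of
  the other, or the factor already assembled, sit in the context.\<close>

lemma derivable_replace_atoms:
  assumes "derivable \<Phi> (mset_sequent (image_mset Atom (tm_atoms B)) + \<Delta>) C"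
  shows "derivable \<Phi> (single B + \<Delta>) C"
  using assms
proof (induction B arbitrary: \<Delta>)
  case (Atom P)
  then show ?case by simp
next
  case One
  then have "derivable \<Phi> (\<Delta> + single \<one>) C"
    by (intro derivable.L_One) simp
  then show ?case by (simp add: add.commute)
next
  case (Tensor A B)
  from Tensor.prems have
    "derivable \<Phi> (mset_sequent (image_mset Atom (tm_atoms A))
      + (mset_sequent (image_mset Atom (tm_atoms B)) + \<Delta>)) C"
    by (simp add: add.assoc)
  from Tensor.IH(1)[OF this] have
    "derivable \<Phi> (mset_sequent (image_mset Atom (tm_atoms B)) + (single A + \<Delta>)) C"
    by (simp add: add.left_commute)
  from Tensor.IH(2)[OF this] have "derivable \<Phi> (single A + single B + \<Delta>) C"
    by (simp add: ac_simps)
  then show ?case by (rule derivable.L_Tensor)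
qed

text \<open>Assembles the terms of \<open>M\<close> one at a time, each finished term moving into
  the context.\<close>

lemma derivable_replace_all_atoms:
  assumes "derivable \<Phi> (mset_sequent (image_mset Atom (\<Sum>B\<in>#M. tm_atoms B)) + \<Delta>) C"
  shows "derivable \<Phi> (mset_sequent M + \<Delta>) C"
  using assms
proof (induction M arbitrary: \<Delta>)
  case empty
  then show ?case by simp
next
  case (add B M)
  from add.prems have
    "derivable \<Phi> (mset_sequent (image_mset Atom (tm_atoms B))
      + (mset_sequent (image_mset Atom (\<Sum>B\<in>#M. tm_atoms B)) + \<Delta>)) C"
    by (simp add: add.assoc)
  from derivable_replace_atoms[OF this] have
    "derivable \<Phi> (mset_sequent (image_mset Atom (\<Sum>B\<in>#M. tm_atoms B)) + (single B + \<Delta>)) C"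
    by (simp add: add.left_commute)
  from add.IH[OF this] show ?case
    by (simp add: ac_simps)
qed

text \<open>Multiset union is itself associative and commutative.\<close>

lemma tensor_eq_atoms: "A \<simeq> B \<Longrightarrow> tm_atoms A = tm_atoms B"
  by (induction rule: tensor_eq.induct) (simp_all add: ac_simps)

lemma tm_atoms_tensor_list: "tm_atoms (tensor_list Bs) = (\<Sum>B\<in>#mset Bs. tm_atoms B)"
  by (induction Bs rule: tensor_list.induct) simp_all

lemma tm_atoms_tensor_list_atoms_ones:
  "tm_atoms (tensor_list (map Atom Ps @ replicate b \<one>)) = mset Ps"
proof -
  have "(\<Sum>B\<in>#mset (map Atom Ps). tm_atoms B) = mset Ps"
    by (induction Ps) simp_all
  then show ?thesis
    by (simp add: tm_atoms_tensor_list)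
qed

theorem corollary8:
  fixes \<Phi> :: "'p set" and \<Gamma> :: "'p sequent" and A :: "'p tm"
  assumes "countable \<Phi>"
    and "sequent_over \<Phi> \<Gamma>"
    and "A \<in> terms_over \<Phi>"
  shows "(derivable \<Phi> \<Gamma> A \<longrightarrow>
            finite_sequent \<Gamma> \<and>
            (\<forall>Bs Ps Qs b a.
               \<Gamma> = listed Bs \<and> set Ps \<subseteq> \<Phi> \<and> set Qs \<subseteq> \<Phi> \<and>
               tensor_list Bs \<simeq> tensor_list (map Atom Ps @ replicate b \<one>) \<and>
               A \<simeq> tensor_list (map Atom Qs @ replicate a \<one>) \<longrightarrow>
               length Ps = length Qs \<and>
               (\<exists>\<pi>. \<pi> permutes {..<length Qs} \<and> (\<forall>j<length Qs. Qs ! j = Ps ! \<pi> j))) \<and>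
            sequent_atoms \<Gamma> = tm_atoms A) \<and>
         (finite_sequent \<Gamma> \<and> sequent_atoms \<Gamma> = tm_atoms A \<longrightarrow> derivable \<Phi> \<Gamma> A)"
proof (intro conjI impI)
  assume "derivable \<Phi> \<Gamma> A"
  then obtain M where M: "\<Gamma> = mset_sequent M" "(\<Sum>B\<in>#M. tm_atoms B) = tm_atoms A"
    by (rule derivable_sound)
  then show "finite_sequent \<Gamma>"
    by (simp add: finite_sequent_mset_sequent)
  from M show atoms: "sequent_atoms \<Gamma> = tm_atoms A"
    by (simp add: sequent_atoms_mset_sequent)
  show "\<forall>Bs Ps Qs b a.
     \<Gamma> = listed Bs \<and> set Ps \<subseteq> \<Phi> \<and> set Qs \<subseteq> \<Phi> \<and>
     tensor_list Bs \<simeq> tensor_list (map Atom Ps @ replicate b \<one>) \<and>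
     A \<simeq> tensor_list (map Atom Qs @ replicate a \<one>) \<longrightarrow>
     length Ps = length Qs \<and>
     (\<exists>\<pi>. \<pi> permutes {..<length Qs} \<and> (\<forall>j<length Qs. Qs ! j = Ps ! \<pi> j))"
  proof (intro allI impI, elim conjE)
    fix Bs Ps Qs b a
    assume \<Gamma>: "\<Gamma> = listed Bs"
      and Ps: "tensor_list Bs \<simeq> tensor_list (map Atom Ps @ replicate b \<one>)"
      and Qs: "A \<simeq> tensor_list (map Atom Qs @ replicate a \<one>)"
    have "mset Ps = sequent_atoms \<Gamma>"
      using tensor_eq_atoms[OF Ps]
      by (simp add: tm_atoms_tensor_list_atoms_ones \<Gamma> listed_eq_mset_sequent
          sequent_atoms_mset_sequent tm_atoms_tensor_list[of Bs])
    also have "\<dots> = mset Qs"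
      using tensor_eq_atoms[OF Qs] by (simp add: tm_atoms_tensor_list_atoms_ones atoms)
    finally have eq: "mset Qs = mset Ps" by simp
    then have len: "length Ps = length Qs"
      by (metis size_mset)
    \<comment> \<open>The orientation of \<open>eq\<close> makes \<pi> index into \<open>Ps\<close>:
      entry \<open>j\<close> of \<open>permute_list \<pi> Ps\<close> is
      \<open>Ps ! \<pi> j\<close>.\<close>
    from eq obtain \<pi> where \<pi>: "\<pi> permutes {..<length Ps}" "permute_list \<pi> Ps = Qs"
      by (rule mset_eq_permutation)
    then have "\<pi> permutes {..<length Qs}" "\<forall>j<length Qs. Qs ! j = Ps ! \<pi> j"
      using len by (metis, metis permute_list_nth)
    with len show "length Ps = length Qs \<and>
        (\<exists>\<pi>. \<pi> permutes {..<length Qs} \<and> (\<forall>j<length Qs. Qs ! j = Ps ! \<pi> j))"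
      by blast
  qed
next
  assume \<Gamma>: "finite_sequent \<Gamma> \<and> sequent_atoms \<Gamma> = tm_atoms A"
  then obtain M where M: "\<Gamma> = mset_sequent M"
    by (blast elim: finite_sequentE)
  with \<Gamma> have "(\<Sum>B\<in>#M. tm_atoms B) = tm_atoms A"
    by (simp add: sequent_atoms_mset_sequent)
  \<comment> \<open>The atoms shared by \<open>M\<close> and \<open>A\<close> are the meeting point:
    they derive \<open>A\<close>, and with empty context they are reassembled into
    \<open>M\<close>.\<close>
  with derivable_from_atoms[OF assms(3)] derivable_replace_all_atoms[of \<Phi> M 0 A]
  show "derivable \<Phi> \<Gamma> A"
    by (simp add: M)
qed

end
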